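(* Let $\mathcal{H}$ and $\mathcal{K}$ be complex Hilbert spaces, let $T\in\mathcal{B}(\mathcal{H})$ have closed range, let $B\in\mathcal{B}(\mathcal{K},\mathcal{H})$ be injective with closed range, let $C\in\mathcal{B}(\mathcal{H},\mathcal{K})$ be surjective, and suppose $T=BC$. Then the following are equivalent: (1) $T$ is EP. (2) $T^*T=C^*B^*BCBB^{\dag}$ and $T^*T=C^*B^*C^{\dag}CBC$. (3) $TT^*=BCC^*B^*C^*(C^* )^{\dag}$ and $TT^*=BCBB^{\dag}C^*B^*$. (4) $T^*T=C^*B^*BCBB^{\dag}$ and $TT^*=BCC^*B^*C^*(C^* )^{\dag}$. (5) $T^*T=C^*B^*C^{\dag}CBC$ and $TT^*=BCBB^{\dag}C^*B^*$.
   Context: $\mathcal{B}(\mathcal{H},\mathcal{K})$ denotes the bounded linear operators from $\mathcal{H}$ to $\mathcal{K}$, and $\mathcal{B}(\mathcal{H})=\mathcal{B}(\mathcal{H},\mathcal{H})$. $\mathcal{N}(T)$ is the kernel of $T$ and $T^*$ its adjoint. An operator $T\in\mathcal{B}(\mathcal{H})$ with closed range is called EP if $\mathcal{N}(T)=\mathcal{N}(T^* )$. The Moore-Penrose inverse of an operator $S\in\mathcal{B}(\mathcal{H},\mathcal{K})$ with closed range is the unique $S^{\dag}\in\mathcal{B}(\mathcal{K},\mathcal{H})$ satisfying $SS^{\dag}S=S$, $S^{\dag}SS^{\dag}=S^{\dag}$, $(SS^{\dag})^*=SS^{\dag}$ and $(S^{\dag}S)^*=S^{\dag}S$. *)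

theory Defs
  imports "HOL-Analysis.Analysis"
begin

text \<open>Complex Hilbert spaces as type classes over the library's real normed spaces. The inner
  product is linear in its first argument. Since the norm of a \<open>real_normed_vector\<close> is
  definite, the axiom \<open>cinner_same\<close> contains positivity and definiteness of the inner
  product as well as its compatibility with the norm.\<close>

class complex_vector = real_vector +
  fixes scaleC :: "complex \<Rightarrow> 'a \<Rightarrow> 'a"
  assumes scaleC_add_right: "scaleC a (x + y) = scaleC a x + scaleC a y"
    and scaleC_add_left: "scaleC (a + b) x = scaleC a x + scaleC b x"
    and scaleC_scaleC: "scaleC a (scaleC b x) = scaleC (a * b) x"
    and scaleC_of_real: "scaleC (complex_of_real r) x = scaleR r x"

class complex_inner = complex_vector + real_normed_vector +
  fixes cinner :: "'a \<Rightarrow> 'a \<Rightarrow> complex"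
  assumes cinner_commute: "cinner x y = cnj (cinner y x)"
    and cinner_add_left: "cinner (x + y) z = cinner x z + cinner y z"
    and cinner_scaleC_left: "cinner (scaleC a x) y = a * cinner x y"
    and cinner_same: "cinner x x = complex_of_real ((norm x)\<^sup>2)"

class chilbert_space = complex_inner + complete_space

definition bounded_clinear :: "('a::complex_inner \<Rightarrow> 'b::complex_inner) \<Rightarrow> bool" where
  "bounded_clinear f \<longleftrightarrow> bounded_linear f \<and> (\<forall>a x. f (scaleC a x) = scaleC a (f x))"

definition cadjoint :: "('a::chilbert_space \<Rightarrow> 'b::chilbert_space) \<Rightarrow> 'b \<Rightarrow> 'a" where
  "cadjoint T = (THE S. bounded_clinear S \<and> (\<forall>x y. cinner (T x) y = cinner x (S y)))"

text \<open>The descriptions by \<open>THE\<close> denote the intended object where it exists: the adjoint for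
  bounded operators, the Moore-Penrose inverse for bounded operators with closed range.\<close>

definition moore_penrose :: "('a::chilbert_space \<Rightarrow> 'b::chilbert_space) \<Rightarrow> 'b \<Rightarrow> 'a" where
  "moore_penrose S = (THE X. bounded_clinear X \<and>
     S \<circ> X \<circ> S = S \<and> X \<circ> S \<circ> X = X \<and>
     cadjoint (S \<circ> X) = S \<circ> X \<and> cadjoint (X \<circ> S) = X \<circ> S)"

definition EP :: "('a::chilbert_space \<Rightarrow> 'a) \<Rightarrow> bool" where
  "EP T \<longleftrightarrow> bounded_clinear T \<and> closed (range T) \<and> {x. T x = 0} = {x. cadjoint T x = 0}"

end

theory Submission
  imports Defs
begin

text \<open>The kernels decide everything. Since \<open>B\<close> is injective and \<open>C\<close> is surjective (so that \<open>C\<^sup>*\<close> is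
  injective), \<open>ker T = ker C\<close> and \<open>ker T\<^sup>* = ker B\<^sup>*\<close>. Let \<open>P = B B\<^sup>\<dagger>\<close> and let \<open>Q\<close> stand for \<open>C\<^sup>\<dagger> C\<close>
  or for \<open>C\<^sup>* (C\<^sup>*)\<^sup>\<dagger>\<close>. These are orthogonal projections with \<open>ker P = ker T\<^sup>*\<close> and \<open>ker Q = ker T\<close>,
  and the four equations of the theorem read

    \<open>T\<^sup>* T = T\<^sup>* T P\<close>, \<open>T\<^sup>* T = T\<^sup>* Q T\<close>, \<open>T T\<^sup>* = T T\<^sup>* Q\<close>, \<open>T T\<^sup>* = T P T\<^sup>*\<close>.

  For any orthogonal projection \<open>E\<close>, each of \<open>T\<^sup>* T = T\<^sup>* T E\<close> and \<open>T T\<^sup>* = T E T\<^sup>*\<close> is equivalent to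
  \<open>T E = T\<close>, that is, to \<open>ker E \<subseteq> ker T\<close> (lemmas \<open>cadjoint_self_compose_proj_iff\<close> and
  \<open>self_cadjoint_compose_proj_iff\<close>). Applied to \<open>T\<close> and \<open>P\<close>, they turn the first and the fourth
  equation into \<open>ker T\<^sup>* \<subseteq> ker T\<close>; applied to \<open>T\<^sup>*\<close> and \<open>Q\<close>, they turn the second and the third into
  \<open>ker T \<subseteq> ker T\<^sup>*\<close>. Each pair of equations in the theorem contains one of
  either kind, so it says that the two kernels agree, which is the EP property.

  The operator theory behind this is built from the projection theorem, which gives the Riesz
  representation and adjoints. A Moore-Penrose inverse of \<open>S\<close> with closed range must be shown to be
  bounded; the analytic core is \<open>cadjoint_bounded_below_on_range\<close>, a consequence of the uniform
  boundedness principle, by which \<open>S\<^sup>*\<close> is bounded below on the range of \<open>S\<close>. It follows that the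
  range of \<open>S\<^sup>*\<close> is closed too, hence that \<open>S = S\<^sup>*\<^sup>*\<close> is bounded below on the range of \<open>S\<^sup>*\<close>.\<close>


section \<open>Complex inner products\<close>

lemma scaleC_minus_one: "scaleC (-1) x = - (x::'a::complex_vector)"
  using scaleC_of_real[of "-1" x] by simp

lemma scaleC_zero_left [simp]: "scaleC 0 x = (0::'a::complex_vector)"
  using scaleC_of_real[of 0 x] by simp

lemma cinner_zero_left [simp]: "cinner 0 y = 0"
  using cinner_scaleC_left[of 0 0 y] by simp

lemma cinner_zero_right [simp]: "cinner x 0 = 0"
  using cinner_commute[of x 0] by simp

lemma cinner_minus_left: "cinner (- x) y = - cinner x y"
  using cinner_scaleC_left[of "-1" x y] by (simp add: scaleC_minus_one)

lemma cinner_diff_left: "cinner (x - y) z = cinner x z - cinner y z"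
  using cinner_add_left[of x "- y" z] by (simp add: cinner_minus_left)

lemma cinner_add_right: "cinner x (y + z) = cinner x y + cinner x z"
  by (metis cinner_commute cinner_add_left complex_cnj_add)

lemma cinner_diff_right: "cinner x (y - z) = cinner x y - cinner x z"
  by (metis cinner_commute cinner_diff_left complex_cnj_diff)

lemma cinner_scaleC_right: "cinner x (scaleC a y) = cnj a * cinner x y"
  by (metis cinner_commute cinner_scaleC_left complex_cnj_mult)

lemma cinner_scaleR_left: "cinner (scaleR r x) y = complex_of_real r * cinner x y"
  by (metis cinner_scaleC_left scaleC_of_real)

lemma cinner_scaleR_right: "cinner x (scaleR r y) = complex_of_real r * cinner x y"
  by (metis cinner_scaleC_right scaleC_of_real complex_cnj_complex_of_real)

lemma cinner_same_eq_0_iff [simp]: "cinner x x = 0 \<longleftrightarrow> x = 0"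
  by (simp add: cinner_same)

lemma cinner_right_ext:
  assumes "\<And>x. cinner x y = cinner x z"
  shows "y = z"
proof -
  have "cinner (y - z) (y - z) = 0"
    using assms by (simp add: cinner_diff_right)
  then show ?thesis by simp
qed

lemma norm_add_sq: "(norm (x + y))\<^sup>2 = (norm x)\<^sup>2 + (norm y)\<^sup>2 + 2 * Re (cinner x y)"
proof -
  have "complex_of_real ((norm (x + y))\<^sup>2)
      = complex_of_real ((norm x)\<^sup>2) + complex_of_real ((norm y)\<^sup>2) + (cinner x y + cinner y x)"
    by (simp only: cinner_same[symmetric] cinner_add_left cinner_add_right) simp
  also have "cinner x y + cinner y x = complex_of_real (2 * Re (cinner x y))"
    by (subst cinner_commute[of y x]) (simp add: complex_add_cnj)
  finally show ?thesis
    by (simp only: of_real_add[symmetric] of_real_eq_iff)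
qed

lemma norm_diff_sq: "(norm (x - y))\<^sup>2 = (norm x)\<^sup>2 + (norm y)\<^sup>2 - 2 * Re (cinner x y)"
  for x y :: "'a::complex_inner"
proof -
  have "cinner x (- y) = - cinner x y"
    using cinner_diff_right[of x 0 y] by simp
  then show ?thesis
    using norm_add_sq[of x "- y"] by simp
qed

lemma norm_scaleC: "norm (scaleC a x) = cmod a * norm (x::'a::complex_inner)"
proof -
  have "complex_of_real ((norm (scaleC a x))\<^sup>2) = (a * cnj a) * complex_of_real ((norm x)\<^sup>2)"
    by (simp add: cinner_same[symmetric] cinner_scaleC_left cinner_scaleC_right del: of_real_power)
  also have "\<dots> = complex_of_real ((cmod a * norm x)\<^sup>2)"
    by (simp add: complex_norm_square[symmetric] power_mult_distrib)
  finally have "(norm (scaleC a x))\<^sup>2 = (cmod a * norm x)\<^sup>2"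
    by (simp only: of_real_eq_iff)
  then show ?thesis by simp
qed

text \<open>Because the norm is a norm by assumption, the Cauchy-Schwarz inequality for the real part is
  the triangle inequality squared; a phase factor then gives the full inequality.\<close>

lemma cinner_Cauchy_Schwarz: "cmod (cinner x y) \<le> norm x * norm (y::'a::complex_inner)"
proof -
  have Re_le: "Re (cinner x y) \<le> norm x * norm y" for x y :: 'a
  proof -
    have "(norm (x + y))\<^sup>2 \<le> (norm x + norm y)\<^sup>2"
      by (intro power_mono norm_triangle_ineq) simp
    then show ?thesis by (simp add: norm_add_sq power2_sum)
  qed
  show ?thesis
  proof (cases "cinner x y = 0")
    case False
    \<comment> \<open>The phase that makes the inner product real and nonnegative.\<close>
    define a where "a = cnj (cinner x y) / complex_of_real (cmod (cinner x y))"
    have a: "cmod a = 1" using False by (simp add: a_def norm_divide)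
    have "cinner (scaleC a x) y = complex_of_real (cmod (cinner x y))"
      using False complex_norm_square[of "cinner x y"]
      by (simp add: a_def cinner_scaleC_left field_simps power2_eq_square)
    then show ?thesis
      using Re_le[of "scaleC a x" y] a by (simp add: norm_scaleC)
  qed simp
qed

lemma bounded_linear_cinner_left: "bounded_linear (\<lambda>x. cinner x y)"
  by (rule bounded_linear_intro[where K = "norm y"])
    (simp_all add: cinner_add_left cinner_scaleR_left scaleR_conv_of_real cinner_Cauchy_Schwarz)

lemma bounded_linear_cinner_right: "bounded_linear (\<lambda>y. cinner x y)"
  by (rule bounded_linear_intro[where K = "norm x"])
    (simp_all add: cinner_add_right cinner_scaleR_right scaleR_conv_of_real
      cinner_Cauchy_Schwarz mult.commute[of _ "norm x"])


section \<open>Orthogonal projection and the Riesz representation\<close>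

text \<open>Complex linear subspaces, given by their closure properties.\<close>

definition csubspace :: "'a::complex_vector set \<Rightarrow> bool" where
  "csubspace M \<longleftrightarrow> 0 \<in> M \<and> (\<forall>x\<in>M. \<forall>y\<in>M. x + y \<in> M) \<and> (\<forall>a. \<forall>x\<in>M. scaleC a x \<in> M)"

lemma csubspace_imp_subspace: "csubspace M \<Longrightarrow> subspace M"
  unfolding csubspace_def subspace_def by (metis scaleC_of_real)

text \<open>A sequence in \<open>M\<close> minimising the distance to \<open>x\<close> is Cauchy by the parallelogram law; at
  its limit \<open>p\<close> the first variation of the distance vanishes, which is orthogonality.\<close>

lemma orthogonal_projection_exists:
  fixes M :: "'a::chilbert_space set"
  assumes M: "csubspace M" and cl: "closed M"
  shows "\<exists>p\<in>M. \<forall>m\<in>M. cinner (x - p) m = 0"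
proof -
  note sub = csubspace_imp_subspace[OF M]
  define D where "D = (\<lambda>m. (norm (x - m))\<^sup>2) ` M"
  define d where "d = Inf D"
  have bdd: "bdd_below D"
    by (rule bdd_belowI[of _ 0]) (auto simp: D_def)
  have ne: "D \<noteq> {}"
    using subspace_0[OF sub] by (auto simp: D_def)
  have d_le: "d \<le> (norm (x - m))\<^sup>2" if "m \<in> M" for m
    unfolding d_def by (rule cInf_lower) (use that bdd in \<open>auto simp: D_def\<close>)
  have "\<exists>m\<in>M. (norm (x - m))\<^sup>2 < d + inverse (real (Suc n))" for n
  proof -
    have "Inf D < d + inverse (real (Suc n))" by (simp add: d_def)
    then show ?thesis
      using cInf_less_iff[OF ne bdd] by (auto simp: D_def)
  qed
  then obtain p where pM: "\<And>n. p n \<in> M"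
    and p: "\<And>n. (norm (x - p n))\<^sup>2 < d + inverse (real (Suc n))"
    by metis
  have par: "(norm (p n - p k))\<^sup>2 \<le> 2 * inverse (real (Suc n)) + 2 * inverse (real (Suc k))" for n k
  proof -
    let ?u = "x - p n" and ?v = "x - p k"
    let ?m = "scaleR (1/2) (p n + p k)"
    have "?m \<in> M"
      by (intro subspace_scale[OF sub] subspace_add[OF sub] pM)
    then have "4 * d \<le> 4 * (norm (x - ?m))\<^sup>2" using d_le by simp
    also have "\<dots> = (norm (scaleR 2 (x - ?m)))\<^sup>2"
      by (simp add: power_mult_distrib)
    also have "scaleR 2 (x - ?m) = ?u + ?v"
      by (simp add: scaleR_2 scaleR_diff_right)
    finally have "4 * d \<le> (norm (?u + ?v))\<^sup>2" .
    moreover have "(norm (?u - ?v))\<^sup>2 = 2 * (norm ?u)\<^sup>2 + 2 * (norm ?v)\<^sup>2 - (norm (?u + ?v))\<^sup>2"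
      unfolding norm_add_sq norm_diff_sq by simp
    moreover have "norm (?u - ?v) = norm (p n - p k)"
      by (simp add: norm_minus_commute)
    ultimately show ?thesis
      using p[of n] p[of k] by simp
  qed
  have "Cauchy p"
  proof (rule metric_CauchyI)
    fix e :: real assume "e > 0"
    then obtain N where N: "inverse (real (Suc N)) < e\<^sup>2 / 4"
      using reals_Archimedean[of "e\<^sup>2 / 4"] by auto
    have "dist (p n) (p k) < e" if "n \<ge> N" "k \<ge> N" for n k
    proof -
      have inv: "inverse (real (Suc j)) \<le> inverse (real (Suc N))" if "j \<ge> N" for j
        using that by (intro le_imp_inverse_le) auto
      have "(norm (p n - p k))\<^sup>2 < e\<^sup>2"
        using par[of n k] inv[of n] inv[of k] that N by linarith
      then have "norm (p n - p k) < e"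
        using \<open>e > 0\<close> by (rule power2_less_imp_less[OF _ less_imp_le])
      then show ?thesis by (simp add: dist_norm)
    qed
    then show "\<exists>N. \<forall>n\<ge>N. \<forall>k\<ge>N. dist (p n) (p k) < e" by blast
  qed
  then obtain q where q: "p \<longlonglongrightarrow> q"
    using Cauchy_convergent convergent_def by blast
  have qM: "q \<in> M"
    using closed_sequentially[OF cl] pM q by blast
  have "(norm (x - q))\<^sup>2 \<le> d + 0"
  proof (rule LIMSEQ_le)
    show "(\<lambda>n. (norm (x - p n))\<^sup>2) \<longlonglongrightarrow> (norm (x - q))\<^sup>2"
      by (intro tendsto_intros q)
    show "(\<lambda>n. d + inverse (real (Suc n))) \<longlonglongrightarrow> d + 0"
      by (intro tendsto_intros LIMSEQ_inverse_real_of_nat)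
  qed (use p less_imp_le in blast)
  then have min: "(norm (x - q))\<^sup>2 \<le> (norm (x - m))\<^sup>2" if "m \<in> M" for m
    using d_le[OF that] by linarith
  have Re0: "Re (cinner (x - q) m) = 0" if m: "m \<in> M" for m
  proof (cases "m = 0")
    case False
    define r where "r = Re (cinner (x - q) m)"
    \<comment> \<open>The step that minimises the distance along the direction \<open>m\<close>.\<close>
    define t where "t = r / (norm m)\<^sup>2"
    have "q + scaleR t m \<in> M"
      by (intro subspace_add[OF sub] subspace_scale[OF sub] qM m)
    then have "(norm (x - q))\<^sup>2 \<le> (norm ((x - q) - scaleR t m))\<^sup>2"
      using min by (metis diff_diff_eq)
    then have "2 * t * r \<le> t\<^sup>2 * (norm m)\<^sup>2"
      by (simp add: norm_diff_sq[of "x - q"] cinner_scaleR_right r_def power_mult_distrib)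
    then have "r\<^sup>2 / (norm m)\<^sup>2 \<le> 0"
      using False by (simp add: t_def power2_eq_square field_simps)
    then have "r\<^sup>2 \<le> 0"
      using False by (simp add: divide_le_0_iff)
    then show ?thesis by (simp add: r_def)
  qed simp
  have "cinner (x - q) m = 0" if m: "m \<in> M" for m
  proof -
    \<comment> \<open>Multiplying \<open>m\<close> by the inner product makes the latter real.\<close>
    let ?c = "cinner (x - q) m"
    have "scaleC ?c m \<in> M" using M m by (simp add: csubspace_def)
    from Re0[OF this] have "Re (?c * cnj ?c) = 0"
      by (simp add: cinner_scaleC_right mult.commute)
    then have "(cmod ?c)\<^sup>2 = 0"
      by (simp add: complex_mult_cnj cmod_power2)
    then show ?thesis by simp
  qed
  with qM show ?thesis by blast
qed

text \<open>The representing vector is a multiple of a vector \<open>w\<close> orthogonal to the kernel; \<open>z\<close> carries the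
  conjugate of \<open>f w\<close> because the inner product is linear in its first argument.\<close>

lemma Riesz_representation:
  fixes f :: "'a::chilbert_space \<Rightarrow> complex"
  assumes lin: "bounded_linear f" and sc: "\<And>a x. f (scaleC a x) = a * f x"
  shows "\<exists>z. \<forall>x. f x = cinner x z"
proof (cases "\<forall>x. f x = 0")
  case True
  then show ?thesis by (intro exI[of _ 0]) simp
next
  case False
  interpret f: bounded_linear f by fact
  define M where "M = {x. f x = 0}"
  have M: "csubspace M"
    by (simp add: csubspace_def M_def f.add f.zero sc)
  have cl: "closed M"
    unfolding M_def by (intro closed_Collect_eq f.continuous_on continuous_intros)
  from False obtain x0 where x0: "f x0 \<noteq> 0" by blast
  obtain p where p: "p \<in> M" "\<And>m. m \<in> M \<Longrightarrow> cinner (x0 - p) m = 0"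
    using orthogonal_projection_exists[OF M cl] by metis
  define w where "w = x0 - p"
  have fw: "f w \<noteq> 0" using x0 p(1) by (simp add: w_def f.diff M_def)
  then have w0: "w \<noteq> 0" using f.zero by auto
  have "f x = cinner x (scaleC (cnj (f w) / complex_of_real ((norm w)\<^sup>2)) w)" for x
  proof -
    have "x - scaleC (f x / f w) w \<in> M"
      using fw by (simp add: M_def f.diff sc)
    then have "cinner w (x - scaleC (f x / f w) w) = 0"
      using p(2) by (simp add: w_def)
    then have "cinner (x - scaleC (f x / f w) w) w = 0"
      by (metis cinner_commute complex_cnj_zero)
    then have "cinner x w = (f x / f w) * complex_of_real ((norm w)\<^sup>2)"
      by (simp add: cinner_diff_left cinner_scaleC_left cinner_same)
    then show ?thesis
      using fw w0 by (simp add: cinner_scaleC_right)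
  qed
  then show ?thesis by blast
qed


section \<open>Bounded operators and their adjoints\<close>

lemma bounded_clinearI:
  assumes "\<And>x y. f (x + y) = f x + f y" "\<And>a x. f (scaleC a x) = scaleC a (f x)"
    and "\<And>x. norm (f x) \<le> norm x * K"
  shows "bounded_clinear f"
  unfolding bounded_clinear_def
  by (intro conjI bounded_linear_intro[where K = K]) (use assms in \<open>simp_all flip: scaleC_of_real\<close>)

lemma bounded_clinear_compose:
  assumes "bounded_clinear f" "bounded_clinear g"
  shows "bounded_clinear (f \<circ> g)"
  using assms bounded_linear_compose[of f g] by (simp add: bounded_clinear_def o_def)

lemma bounded_clinearD:
  assumes "bounded_clinear f"
  shows "f (x + y) = f x + f y" "f (x - y) = f x - f y" "f 0 = 0" "f (scaleC a x) = scaleC a (f x)"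
proof -
  interpret f: bounded_linear f using assms by (simp add: bounded_clinear_def)
  show "f (x + y) = f x + f y" "f (x - y) = f x - f y" "f 0 = 0" "f (scaleC a x) = scaleC a (f x)"
    using assms by (simp_all add: f.add f.diff f.zero bounded_clinear_def)
qed

lemma csubspace_range:
  assumes "bounded_clinear f"
  shows "csubspace (range f)"
  unfolding csubspace_def
  by (auto simp flip: bounded_clinearD(1,4)[OF assms])
    (metis bounded_clinearD(3)[OF assms] rangeI)

text \<open>The adjoint relation alone pins the operator down, by \<open>cinner_right_ext\<close>; boundedness of \<open>S\<close>
  is what makes it the object described by the definition of \<open>cadjoint\<close>.\<close>

lemma cadjoint_eqI:
  assumes S: "bounded_clinear S" and adj: "\<And>x y. cinner (T x) y = cinner x (S y)"
  shows "cadjoint T = S"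
  unfolding cadjoint_def
proof (rule the_equality)
  fix R assume "bounded_clinear R \<and> (\<forall>x y. cinner (T x) y = cinner x (R y))"
  then show "R = S"
    using adj by (intro ext cinner_right_ext) metis
qed (use assms in blast)

lemma cadjoint_exists:
  fixes T :: "'a::chilbert_space \<Rightarrow> 'b::chilbert_space"
  assumes T: "bounded_clinear T"
  shows "\<exists>S. bounded_clinear S \<and> (\<forall>x y. cinner (T x) y = cinner x (S y))"
proof -
  have blT: "bounded_linear T" using T by (simp add: bounded_clinear_def)
  have "\<exists>z. \<forall>x. cinner (T x) y = cinner x z" for y
    by (rule Riesz_representation)
      (simp_all add: bounded_linear_compose[OF bounded_linear_cinner_left blT]
        bounded_clinearD[OF T] cinner_scaleC_left)
  then obtain S where S: "\<And>x y. cinner (T x) y = cinner x (S y)" by metis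
  obtain K where K: "K \<ge> 0" "\<And>x. norm (T x) \<le> norm x * K"
    using bounded_linear.nonneg_bounded[OF blT] by blast
  have "bounded_clinear S"
  proof (rule bounded_clinearI)
    show "S (x + y) = S x + S y" for x y
      by (rule cinner_right_ext) (simp add: cinner_add_right flip: S)
    show "S (scaleC a x) = scaleC a (S x)" for a x
      by (rule cinner_right_ext) (simp add: cinner_scaleC_right flip: S)
    show "norm (S y) \<le> norm y * K" for y
    proof (cases "S y = 0")
      case False
      have "(norm (S y))\<^sup>2 = cmod (cinner (S y) (S y))"
        by (simp add: cinner_same norm_power)
      also have "\<dots> = cmod (cinner (T (S y)) y)" by (simp add: S)
      also have "\<dots> \<le> norm (T (S y)) * norm y" by (rule cinner_Cauchy_Schwarz)
      also have "\<dots> \<le> norm (S y) * K * norm y" by (intro mult_right_mono K) simp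
      finally have "norm (S y) * norm (S y) \<le> norm (S y) * (norm y * K)"
        by (simp add: power2_eq_square mult_ac)
      then show ?thesis using False by simp
    qed (use K in simp)
  qed
  with S show ?thesis by blast
qed

lemma
  assumes "bounded_clinear T"
  shows bounded_clinear_cadjoint: "bounded_clinear (cadjoint T)"
    and cinner_cadjoint: "cinner (T x) y = cinner x (cadjoint T y)"
  using cadjoint_exists[OF assms] cadjoint_eqI by metis+

lemma cinner_cadjoint': "bounded_clinear T \<Longrightarrow> cinner (cadjoint T x) y = cinner x (T y)"
  by (metis cinner_cadjoint cinner_commute)

lemma cadjoint_cadjoint: "bounded_clinear T \<Longrightarrow> cadjoint (cadjoint T) = T"
  by (intro cadjoint_eqI cinner_cadjoint')

lemma cadjoint_compose:
  assumes "bounded_clinear S" "bounded_clinear T"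
  shows "cadjoint (S \<circ> T) = cadjoint T \<circ> cadjoint S"
  using assms
  by (intro cadjoint_eqI bounded_clinear_compose bounded_clinear_cadjoint) (simp_all add: cinner_cadjoint)

lemma cadjoint_apply_self_eq_0_iff:
  assumes "bounded_clinear T"
  shows "cadjoint T (T x) = 0 \<longleftrightarrow> T x = 0"
proof
  assume "cadjoint T (T x) = 0"
  then have "cinner (T x) (T x) = 0" by (simp add: cinner_cadjoint[OF assms])
  then show "T x = 0" by simp
qed (simp add: bounded_clinearD(3)[OF bounded_clinear_cadjoint[OF assms]])


section \<open>Uniform boundedness and closed ranges\<close>

text \<open>Uniform boundedness principle for the functionals represented by the elements of \<open>A\<close>: by
  Baire's theorem a single bound holds for them on some ball, and differences of two points of the
  ball reach every direction.\<close>

lemma weakly_bounded_imp_bounded: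
  fixes A :: "'a::chilbert_space set"
  assumes bd: "\<And>k. \<exists>b. \<forall>y\<in>A. cmod (cinner y k) \<le> b"
  shows "\<exists>K. \<forall>y\<in>A. norm y \<le> K"
proof -
  define F where "F n = {k. \<forall>y\<in>A. cmod (cinner y k) \<le> real n}" for n :: nat
  have closedF: "closed (F n)" for n
  proof -
    have "F n = (\<Inter>y\<in>A. {k. cmod (cinner y k) \<le> real n})" by (auto simp: F_def)
    moreover have "closed {k. cmod (cinner y k) \<le> real n}" for y :: 'a
      by (intro closed_Collect_le continuous_on_const continuous_on_norm continuous_on_id
          bounded_linear.continuous_on[OF bounded_linear_cinner_right])
    ultimately show ?thesis by (metis (no_types, lifting) closed_INT)
  qed
  have cover: "(\<Union>n. F n) = UNIV"
  proof -
    have "k \<in> (\<Union>n. F n)" for k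
    proof -
      obtain b where b: "\<forall>y\<in>A. cmod (cinner y k) \<le> b" using bd by blast
      obtain n where "b \<le> real n" using real_arch_simple by blast
      with b have "k \<in> F n" unfolding F_def by (blast intro: order_trans)
      then show ?thesis by blast
    qed
    then show ?thesis by blast
  qed
  have "\<exists>n. interior (F n) \<noteq> {}"
  proof (rule ccontr)
    assume "\<not> ?thesis"
    then have "Met_TC.mtopology interior_of \<Union>(range F) = {}"
      using closedF by (intro Met_TC.metric_Baire_category_alt) (auto simp: complete_UNIV)
    then show False by (simp add: cover)
  qed
  then obtain n k0 r where r: "r > 0" "ball k0 r \<subseteq> F n"
    by (metis all_not_in_conv mem_interior)
  have "norm y \<le> 4 * real n / r" if y: "y \<in> A" for y
  proof (cases "y = 0")
    case False
    \<comment> \<open>The factor keeps \<open>k0 + u\<close> inside the ball.\<close>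
    define u where "u = scaleR (r / (2 * norm y)) y"
    have "k0 \<in> ball k0 r" "k0 + u \<in> ball k0 r"
      using r(1) False by (simp_all add: dist_norm u_def)
    then have "k0 \<in> F n" "k0 + u \<in> F n" using r(2) by blast+
    then have "cmod (cinner y k0) \<le> real n" "cmod (cinner y (k0 + u)) \<le> real n"
      using y by (auto simp: F_def)
    moreover have "cinner y u = cinner y (k0 + u) - cinner y k0"
      by (simp add: cinner_add_right)
    ultimately have "cmod (cinner y u) \<le> 2 * real n"
      using norm_triangle_ineq4[of "cinner y (k0 + u)" "cinner y k0"] by simp
    moreover have "cmod (cinner y u) = r / 2 * norm y"
      using r False
      by (simp add: u_def cinner_scaleR_right cinner_same norm_mult norm_power norm_divide power2_eq_square)
    ultimately show ?thesis using r by (simp add: field_simps)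
  qed (use r in simp)
  then show ?thesis by blast
qed

text \<open>For \<open>y\<close> in the range with \<open>norm (S\<^sup>* y) \<le> 1\<close>, the scalars \<open>\<langle>y, S x\<rangle> = \<langle>S\<^sup>* y, x\<rangle>\<close> are bounded
  for each \<open>x\<close>, so such \<open>y\<close> form a weakly bounded set.\<close>

lemma cadjoint_bounded_below_on_range:
  fixes S :: "'a::chilbert_space \<Rightarrow> 'b::chilbert_space"
  assumes S: "bounded_clinear S" and cl: "closed (range S)"
  shows "\<exists>c>0. \<forall>y\<in>range S. c * norm y \<le> norm (cadjoint S y)"
proof -
  note adj = bounded_clinear_cadjoint[OF S]
  define A where "A = {y \<in> range S. norm (cadjoint S y) \<le> 1}"
  have "\<exists>b. \<forall>y\<in>A. cmod (cinner y k) \<le> b" for k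
  proof -
    obtain x where x: "\<And>m. m \<in> range S \<Longrightarrow> cinner (k - S x) m = 0"
      using orthogonal_projection_exists[OF csubspace_range[OF S] cl] by (metis imageE)
    have "cmod (cinner y k) \<le> norm x" if y: "y \<in> A" for y
    proof -
      have "cinner y (k - S x) = 0"
        using x[of y] y cinner_commute[of y "k - S x"] by (simp add: A_def)
      then have "cinner y k = cinner (cadjoint S y) x"
        by (simp add: cinner_diff_right cinner_cadjoint'[OF S])
      also have "cmod \<dots> \<le> norm (cadjoint S y) * norm x" by (rule cinner_Cauchy_Schwarz)
      also have "\<dots> \<le> 1 * norm x" using y by (intro mult_right_mono) (auto simp: A_def)
      finally show ?thesis by simp
    qed
    then show ?thesis by blast
  qed
  then obtain K0 where K0: "\<forall>y\<in>A. norm y \<le> K0"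
    using weakly_bounded_imp_bounded by blast
  \<comment> \<open>A positive bound is needed, as its inverse becomes the constant \<open>c\<close>.\<close>
  define K where "K = max K0 1"
  have K: "K > 0" "\<And>y. y \<in> A \<Longrightarrow> norm y \<le> K"
    using K0 by (auto simp: K_def max_def)
  have "inverse K * norm y \<le> norm (cadjoint S y)" if y: "y \<in> range S" for y
  proof (cases "cadjoint S y = 0")
    case True
    with y have "y = 0" using cadjoint_apply_self_eq_0_iff[OF S] by auto
    then show ?thesis by simp
  next
    case False
    define t where "t = norm (cadjoint S y)"
    have t: "t > 0" using False by (simp add: t_def)
    let ?a = "complex_of_real (inverse t)"
    have "scaleC ?a y \<in> range S"
      using csubspace_range[OF S] y unfolding csubspace_def by blast
    then have "scaleC ?a y \<in> A"
      using t by (simp add: A_def bounded_clinearD(4)[OF adj] norm_scaleC norm_inverse flip: t_def)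
    from K(2)[OF this] have "inverse t * norm y \<le> K"
      using t by (simp add: norm_scaleC norm_inverse)
    then show ?thesis using t K(1) by (simp add: t_def[symmetric] field_simps)
  qed
  then show ?thesis using K(1) by (intro exI[of _ "inverse K"]) simp
qed

text \<open>Take \<open>S x\<close> to be the orthogonal projection of \<open>y\<close> onto the range: the adjoint vanishes on the
  orthogonal complement of that range.\<close>

lemma ex_cadjoint_eq_on_range:
  fixes S :: "'a::chilbert_space \<Rightarrow> 'b::chilbert_space"
  assumes S: "bounded_clinear S" and cl: "closed (range S)"
  shows "\<exists>x. cadjoint S y = cadjoint S (S x)"
proof -
  obtain x where x: "\<And>m. m \<in> range S \<Longrightarrow> cinner (y - S x) m = 0"
    using orthogonal_projection_exists[OF csubspace_range[OF S] cl] by (metis imageE)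
  have "cadjoint S (y - S x) = 0"
  proof (rule cinner_right_ext)
    fix z
    have "cinner (S z) (y - S x) = 0"
      using x[of "S z"] cinner_commute[of "S z" "y - S x"] by simp
    then show "cinner z (cadjoint S (y - S x)) = cinner z 0"
      by (simp add: cinner_cadjoint[OF S])
  qed
  then have "cadjoint S y = cadjoint S (S x)"
    by (simp add: bounded_clinearD(2)[OF bounded_clinear_cadjoint[OF S]])
  then show ?thesis by blast
qed

lemma closed_range_cadjoint:
  fixes S :: "'a::chilbert_space \<Rightarrow> 'b::chilbert_space"
  assumes S: "bounded_clinear S" and cl: "closed (range S)"
  shows "closed (range (cadjoint S))"
proof -
  note adj = bounded_clinear_cadjoint[OF S]
  obtain c where c: "c > 0" "\<forall>y\<in>range S. c * norm y \<le> norm (cadjoint S y)"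
    using cadjoint_bounded_below_on_range[OF S cl] by blast
  have "complete (cadjoint S ` range S)"
  proof (rule complete_isometric_image[OF c(1) _ _ c(2)])
    show "subspace (range S)" by (rule csubspace_imp_subspace[OF csubspace_range[OF S]])
    show "bounded_linear (cadjoint S)" using adj by (simp add: bounded_clinear_def)
    show "complete (range S)" using cl by (simp add: complete_eq_closed)
  qed
  moreover have "cadjoint S ` range S = range (cadjoint S)"
  proof (intro antisym subsetI)
    fix u assume "u \<in> range (cadjoint S)"
    then obtain y where "u = cadjoint S y" by blast
    then show "u \<in> cadjoint S ` range S"
      using ex_cadjoint_eq_on_range[OF S cl, of y] by auto
  qed blast
  ultimately show ?thesis by (simp add: complete_imp_closed)
qed


section \<open>The Moore-Penrose inverse\<close>

text \<open>The conditions that characterise the Moore-Penrose inverse of a bounded operator \<open>S\<close> with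
  closed range. For bounded \<open>S\<close> the values of \<open>cadjoint\<close> in them are genuine adjoints.\<close>

definition is_moore_penrose :: "('a::chilbert_space \<Rightarrow> 'b::chilbert_space) \<Rightarrow> ('b \<Rightarrow> 'a) \<Rightarrow> bool" where
  "is_moore_penrose S X \<longleftrightarrow> bounded_clinear X \<and>
     S \<circ> X \<circ> S = S \<and> X \<circ> S \<circ> X = X \<and>
     cadjoint (S \<circ> X) = S \<circ> X \<and> cadjoint (X \<circ> S) = X \<circ> S"

text \<open>The orthogonal projections \<open>S X\<close> and \<open>X S\<close> are determined by the range of \<open>S\<close> and the kernel
  of \<open>S\<close> respectively; these two products determine \<open>X = X S X\<close>.\<close>

lemma is_moore_penrose_unique:
  assumes S: "bounded_clinear S" and X: "is_moore_penrose S X" and Y: "is_moore_penrose S Y"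
  shows "X = Y"
proof -
  have bX: "bounded_clinear X" and bY: "bounded_clinear Y"
    using X Y by (auto simp: is_moore_penrose_def)
  note comp = bounded_clinear_compose
  have SXS: "S (X (S z)) = S z" and SYS: "S (Y (S z)) = S z" for z
    using X Y by (auto simp: is_moore_penrose_def fun_eq_iff)
  have XSX: "X (S (X y)) = X y" and YSY: "Y (S (Y y)) = Y y" for y
    using X Y by (auto simp: is_moore_penrose_def fun_eq_iff)
  have "S \<circ> X = cadjoint ((S \<circ> Y) \<circ> (S \<circ> X))"
    using X SYS by (simp add: is_moore_penrose_def o_def)
  also have "\<dots> = (S \<circ> X) \<circ> (S \<circ> Y)"
    using X Y by (simp add: cadjoint_compose comp[OF S bX] comp[OF S bY] is_moore_penrose_def)
  also have "\<dots> = S \<circ> Y" using SXS by (simp add: o_def)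
  finally have SX: "S (X y) = S (Y y)" for y by (simp add: fun_eq_iff)
  have "X \<circ> S = cadjoint ((X \<circ> S) \<circ> (Y \<circ> S))"
    using X SYS by (simp add: is_moore_penrose_def o_def)
  also have "\<dots> = (Y \<circ> S) \<circ> (X \<circ> S)"
    using X Y by (simp add: cadjoint_compose comp[OF bX S] comp[OF bY S] is_moore_penrose_def)
  also have "\<dots> = Y \<circ> S" using SXS by (simp add: o_def)
  finally have XS: "X (S z) = Y (S z)" for z by (simp add: fun_eq_iff)
  show ?thesis
    by (rule ext) (metis XSX YSY SX XS)
qed

text \<open>It suffices that \<open>w - E w\<close> is always orthogonal to the range of \<open>E\<close>: both \<open>\<langle>E y, w\<rangle>\<close> and
  \<open>\<langle>y, E w\<rangle>\<close> then equal \<open>\<langle>E y, E w\<rangle>\<close>.\<close>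

lemma self_adjointI:
  assumes E: "bounded_clinear E" and orth: "\<And>y w. cinner (E y) (w - E w) = 0"
  shows "cadjoint E = E"
proof (rule cadjoint_eqI[OF E])
  have *: "cinner (E y) w = cinner (E y) (E w)" for y w
    using orth by (simp add: cinner_diff_right)
  show "cinner (E y) w = cinner y (E w)" for y w
    by (metis * cinner_commute)
qed

text \<open>The value at \<open>y\<close> is the solution \<open>x\<close> of the normal equation \<open>S\<^sup>* S x = S\<^sup>* y\<close> in the range
  of \<open>S\<^sup>*\<close>, the orthogonal complement of the kernel of \<open>S\<close>. It depends continuously on \<open>y\<close> because
  \<open>S\<close> is bounded below on that range.\<close>

lemma is_moore_penrose_exists:
  fixes S :: "'a::chilbert_space \<Rightarrow> 'b::chilbert_space"
  assumes S: "bounded_clinear S" and cl: "closed (range S)"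
  shows "\<exists>X. is_moore_penrose S X"
proof -
  note adj = bounded_clinear_cadjoint[OF S]
  note cl' = closed_range_cadjoint[OF S cl]
  let ?R = "range (cadjoint S)"
  have csR: "csubspace ?R" by (rule csubspace_range[OF adj])
  note sub = csubspace_imp_subspace[OF csR]
  have scR: "scaleC a x \<in> ?R" if "x \<in> ?R" for a x
    using csR that unfolding csubspace_def by blast
  have ker: "S z = 0" if "cadjoint S (S z) = 0" for z
    using that cadjoint_apply_self_eq_0_iff[OF S] by blast
  have ker': "x = 0" if "S x = 0" "x \<in> ?R" for x
    using that cadjoint_apply_self_eq_0_iff[OF adj] by (auto simp: cadjoint_cadjoint[OF S])
  have uniq: "x = x'" if "x \<in> ?R" "x' \<in> ?R" "cadjoint S (S x) = cadjoint S (S x')" for x x'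
  proof -
    have "x - x' \<in> ?R" using that subspace_diff[OF sub] by blast
    moreover have "S (x - x') = 0"
      using that by (intro ker) (simp add: bounded_clinearD[OF S] bounded_clinearD[OF adj])
    ultimately show ?thesis using ker' by force
  qed
  have "\<exists>x\<in>?R. cadjoint S (S x) = cadjoint S y" for y
  proof -
    obtain z where z: "cadjoint S y = cadjoint S (S z)"
      using ex_cadjoint_eq_on_range[OF S cl] by blast
    obtain x where x: "x \<in> ?R" "\<And>m. m \<in> ?R \<Longrightarrow> cinner (z - x) m = 0"
      using orthogonal_projection_exists[OF csR cl'] by metis
    have "cinner (S (z - x)) (S (z - x)) = 0"
      using x(2) by (simp add: cinner_cadjoint[OF S])
    then have "S z = S x" by (simp add: bounded_clinearD[OF S])
    then show ?thesis using x(1) z by auto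
  qed
  then obtain X where XR: "\<And>y. X y \<in> ?R" and X: "\<And>y. cadjoint S (S (X y)) = cadjoint S y"
    by metis
  obtain c where c: "c > 0" "\<And>x. x \<in> ?R \<Longrightarrow> c * norm x \<le> norm (S x)"
    using cadjoint_bounded_below_on_range[OF adj cl'] by (auto simp: cadjoint_cadjoint[OF S])
  have bX: "bounded_clinear X"
  proof (rule bounded_clinearI)
    show "X (x + y) = X x + X y" for x y
      by (rule uniq) (simp_all add: XR X subspace_add[OF sub] bounded_clinearD[OF S] bounded_clinearD[OF adj])
    show "X (scaleC a x) = scaleC a (X x)" for a x
      by (rule uniq) (simp_all add: XR X scR bounded_clinearD[OF S] bounded_clinearD[OF adj])
    show "norm (X y) \<le> norm y * inverse c" for y
    proof -
      have "(norm (S (X y)))\<^sup>2 = cmod (cinner (S (X y)) (S (X y)))"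
        by (simp add: cinner_same norm_power)
      also have "\<dots> = cmod (cinner (S (X y)) y)"
        by (simp add: cinner_cadjoint[OF S] X)
      also have "\<dots> \<le> norm (S (X y)) * norm y" by (rule cinner_Cauchy_Schwarz)
      finally have "norm (S (X y)) \<le> norm y"
        by (cases "S (X y) = 0") (simp_all add: power2_eq_square)
      then have "c * norm (X y) \<le> norm y" using c(2)[OF XR, of y] by linarith
      then show ?thesis using c(1) by (simp add: field_simps)
    qed
  qed
  have SXS: "S (X (S z)) = S z" for z
  proof -
    have "S (X (S z) - z) = 0"
      by (rule ker) (simp add: X bounded_clinearD[OF S] bounded_clinearD[OF adj])
    then show ?thesis by (simp add: bounded_clinearD[OF S])
  qed
  have XSX: "X (S (X y)) = X y" for y
    by (rule uniq) (simp_all add: XR X)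
  have "cadjoint (S \<circ> X) = S \<circ> X"
    by (rule self_adjointI)
      (simp_all add: bounded_clinear_compose S bX cinner_cadjoint[OF S] bounded_clinearD[OF adj] X)
  moreover have "cadjoint (X \<circ> S) = X \<circ> S"
  proof (rule self_adjointI)
    fix y w
    obtain u where "X (S y) = cadjoint S u" using XR by blast
    then show "cinner ((X \<circ> S) y) (w - (X \<circ> S) w) = 0"
      by (simp add: cinner_cadjoint'[OF S] bounded_clinearD[OF S] SXS)
  qed (intro bounded_clinear_compose S bX)
  ultimately have "is_moore_penrose S X"
    using bX SXS XSX by (simp add: is_moore_penrose_def fun_eq_iff)
  then show ?thesis by blast
qed

lemma is_moore_penrose_moore_penrose:
  assumes "bounded_clinear S" "closed (range S)"
  shows "is_moore_penrose S (moore_penrose S)"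
proof -
  have "moore_penrose S = (THE X. is_moore_penrose S X)"
    by (simp add: moore_penrose_def is_moore_penrose_def)
  then show ?thesis
    using is_moore_penrose_exists[OF assms] is_moore_penrose_unique[OF assms(1)]
    by (metis the_equality)
qed


section \<open>Orthogonal projections and the products with the adjoint\<close>

text \<open>Orthogonal projections as bounded self-adjoint idempotents.\<close>

definition orth_proj :: "('a::chilbert_space \<Rightarrow> 'a) \<Rightarrow> bool" where
  "orth_proj E \<longleftrightarrow> bounded_clinear E \<and> E \<circ> E = E \<and> cadjoint E = E"

lemma
  assumes S: "bounded_clinear S" and cl: "closed (range S)"
  shows orth_proj_mp_range: "orth_proj (S \<circ> moore_penrose S)"
    and ker_mp_range: "{x. (S \<circ> moore_penrose S) x = 0} = {x. cadjoint S x = 0}"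
    and orth_proj_mp_corange: "orth_proj (moore_penrose S \<circ> S)"
    and ker_mp_corange: "{x. (moore_penrose S \<circ> S) x = 0} = {x. S x = 0}"
proof -
  let ?X = "moore_penrose S"
  note mp = is_moore_penrose_moore_penrose[OF assms]
  have X: "bounded_clinear ?X" and SXS: "\<And>z. S (?X (S z)) = S z"
    and XSX: "\<And>y. ?X (S (?X y)) = ?X y"
    and selfadj: "cadjoint (S \<circ> ?X) = S \<circ> ?X" and selfadj': "cadjoint (?X \<circ> S) = ?X \<circ> S"
    using mp by (auto simp: is_moore_penrose_def fun_eq_iff)
  show "orth_proj (S \<circ> ?X)" "orth_proj (?X \<circ> S)"
    using selfadj selfadj' bounded_clinear_compose[OF S X] bounded_clinear_compose[OF X S]
    by (simp_all add: orth_proj_def fun_eq_iff SXS XSX)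
  show "{x. (?X \<circ> S) x = 0} = {x. S x = 0}"
    using SXS bounded_clinearD(3)[OF X] bounded_clinearD(3)[OF S] by (auto simp: o_def) metis
  have 1: "S \<circ> ?X = cadjoint ?X \<circ> cadjoint S"
    using selfadj by (simp add: cadjoint_compose[OF S X])
  have "cadjoint S = cadjoint ((S \<circ> ?X) \<circ> S)" by (simp add: o_def SXS)
  also have "\<dots> = cadjoint S \<circ> (S \<circ> ?X)"
    by (simp only: cadjoint_compose[OF bounded_clinear_compose[OF S X] S] selfadj)
  finally have 2: "cadjoint S x = cadjoint S (S (?X x))" for x by (simp add: fun_eq_iff)
  show "{x. (S \<circ> ?X) x = 0} = {x. cadjoint S x = 0}"
  proof (intro Collect_cong iffI)
    show "cadjoint S x = 0" if "(S \<circ> ?X) x = 0" for x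
      using that 2[of x] by (simp add: bounded_clinearD(3)[OF bounded_clinear_cadjoint[OF S]])
    show "(S \<circ> ?X) x = 0" if "cadjoint S x = 0" for x
      unfolding 1 using that by (simp add: bounded_clinearD(3)[OF bounded_clinear_cadjoint[OF X]])
  qed
qed

lemma compose_orth_proj_eq_iff:
  assumes T: "bounded_clinear T" and E: "orth_proj E"
  shows "T \<circ> E = T \<longleftrightarrow> {x. E x = 0} \<subseteq> {x. T x = 0}"
proof
  assume "T \<circ> E = T"
  then show "{x. E x = 0} \<subseteq> {x. T x = 0}"
    by (metis (mono_tags, lifting) Collect_mono bounded_clinearD(3)[OF T] comp_apply)
next
  assume sub: "{x. E x = 0} \<subseteq> {x. T x = 0}"
  have bE: "bounded_clinear E" and EE: "\<And>x. E (E x) = E x"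
    using E by (auto simp: orth_proj_def fun_eq_iff)
  have "T (x - E x) = 0" for x
  proof -
    have "E (x - E x) = 0" by (simp add: bounded_clinearD[OF bE] EE)
    then show ?thesis using sub by blast
  qed
  then show "T \<circ> E = T" by (simp add: fun_eq_iff bounded_clinearD[OF T])
qed

text \<open>On the range of \<open>T\<close> the adjoint is injective, so it can be cancelled on the left.\<close>

lemma cadjoint_self_compose_proj_iff:
  assumes T: "bounded_clinear T" and E: "orth_proj E"
  shows "cadjoint T \<circ> T = cadjoint T \<circ> T \<circ> E \<longleftrightarrow> {x. E x = 0} \<subseteq> {x. T x = 0}"
  unfolding compose_orth_proj_eq_iff[OF assms, symmetric]
proof
  note adj = bounded_clinear_cadjoint[OF T]
  assume eq: "cadjoint T \<circ> T = cadjoint T \<circ> T \<circ> E"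
  have "T (E x - x) = 0" for x
    using eq cadjoint_apply_self_eq_0_iff[OF T, of "E x - x"]
    by (simp add: fun_eq_iff bounded_clinearD[OF T] bounded_clinearD[OF adj])
  then show "T \<circ> E = T" by (simp add: fun_eq_iff bounded_clinearD[OF T])
qed (simp add: comp_assoc)

text \<open>The hypothesis says that \<open>\<langle>E z, z\<rangle> = \<langle>z, z\<rangle>\<close> for \<open>z\<close> in the range of \<open>T\<^sup>*\<close>, hence that \<open>E\<close>
  fixes this range.\<close>

lemma self_cadjoint_compose_proj_iff:
  assumes T: "bounded_clinear T" and E: "orth_proj E"
  shows "T \<circ> cadjoint T = T \<circ> E \<circ> cadjoint T \<longleftrightarrow> {x. E x = 0} \<subseteq> {x. T x = 0}"
  unfolding compose_orth_proj_eq_iff[OF assms, symmetric]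
proof
  note adj = bounded_clinear_cadjoint[OF T]
  have bE: "bounded_clinear E" and EE: "\<And>x. E (E x) = E x" and sE: "cadjoint E = E"
    using E by (auto simp: orth_proj_def fun_eq_iff)
  assume eq: "T \<circ> cadjoint T = T \<circ> E \<circ> cadjoint T"
  have "E (cadjoint T x) = cadjoint T x" for x
  proof -
    let ?z = "cadjoint T x"
    have "cinner (?z - E ?z) ?z = cinner (T (?z - E ?z)) x"
      by (simp add: cinner_cadjoint[OF T])
    also have "\<dots> = 0"
      using eq by (simp add: fun_eq_iff bounded_clinearD[OF T])
    finally have "cinner (?z - E ?z) ?z = 0" .
    moreover have "cinner (?z - E ?z) (E ?z) = cinner (E (?z - E ?z)) ?z"
      by (simp add: cinner_cadjoint[OF bE] sE)
    ultimately have "cinner (?z - E ?z) (?z - E ?z) = 0"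
      by (simp add: cinner_diff_right[of _ ?z] bounded_clinearD[OF bE] EE)
    then show ?thesis by simp
  qed
  then have "E \<circ> cadjoint T = cadjoint T" by (simp add: fun_eq_iff)
  then have "cadjoint (E \<circ> cadjoint T) = cadjoint (cadjoint T)" by simp
  then show "T \<circ> E = T"
    by (simp add: cadjoint_compose[OF bE adj] cadjoint_cadjoint[OF T] sE)
qed simp


section \<open>Characterisations of EP operators by a full rank factorisation\<close>

theorem theorem5p5:
  fixes T :: "'h::chilbert_space \<Rightarrow> 'h"
    and B :: "'k::chilbert_space \<Rightarrow> 'h"
    and C :: "'h \<Rightarrow> 'k"
  assumes "bounded_clinear T" and "closed (range T)"
    and "bounded_clinear B" and "inj B" and "closed (range B)"
    and "bounded_clinear C" and "surj C"
    and "T = B \<circ> C"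
  shows
    "(EP T \<longleftrightarrow>
        cadjoint T \<circ> T = cadjoint C \<circ> cadjoint B \<circ> B \<circ> C \<circ> B \<circ> moore_penrose B \<and>
        cadjoint T \<circ> T = cadjoint C \<circ> cadjoint B \<circ> moore_penrose C \<circ> C \<circ> B \<circ> C) \<and>
     (EP T \<longleftrightarrow>
        T \<circ> cadjoint T = B \<circ> C \<circ> cadjoint C \<circ> cadjoint B \<circ> cadjoint C \<circ> moore_penrose (cadjoint C) \<and>
        T \<circ> cadjoint T = B \<circ> C \<circ> B \<circ> moore_penrose B \<circ> cadjoint C \<circ> cadjoint B) \<and>
     (EP T \<longleftrightarrow>
        cadjoint T \<circ> T = cadjoint C \<circ> cadjoint B \<circ> B \<circ> C \<circ> B \<circ> moore_penrose B \<and>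
        T \<circ> cadjoint T = B \<circ> C \<circ> cadjoint C \<circ> cadjoint B \<circ> cadjoint C \<circ> moore_penrose (cadjoint C)) \<and>
     (EP T \<longleftrightarrow>
        cadjoint T \<circ> T = cadjoint C \<circ> cadjoint B \<circ> moore_penrose C \<circ> C \<circ> B \<circ> C \<and>
        T \<circ> cadjoint T = B \<circ> C \<circ> B \<circ> moore_penrose B \<circ> cadjoint C \<circ> cadjoint B)"
proof -
  note T = assms(1) and B = assms(3) and C = assms(6)
  have clC: "closed (range C)" using \<open>surj C\<close> by simp
  note adjT = bounded_clinear_cadjoint[OF T]
    and adjC = bounded_clinear_cadjoint[OF C]
  have T': "cadjoint T = cadjoint C \<circ> cadjoint B"
    using cadjoint_compose[OF B C] assms(8) by simp
  let ?P = "B \<circ> moore_penrose B"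
    and ?Q = "moore_penrose C \<circ> C"
    and ?Q' = "cadjoint C \<circ> moore_penrose (cadjoint C)"
  have "T x = 0 \<longleftrightarrow> C x = 0" for x
    using injD[OF \<open>inj B\<close>, of "C x" 0] bounded_clinearD(3)[OF B] assms(8) by auto
  then have kerT: "{x. T x = 0} = {x. C x = 0}" by simp
  have "cadjoint C u = 0 \<longleftrightarrow> u = 0" for u
  proof -
    obtain x where "u = C x" using \<open>surj C\<close> by blast
    then show ?thesis using cadjoint_apply_self_eq_0_iff[OF C] by simp
  qed
  then have kerT': "{x. cadjoint T x = 0} = {x. cadjoint B x = 0}" by (simp add: T')
  have kerP: "{x. ?P x = 0} = {x. cadjoint T x = 0}"
    using ker_mp_range[OF B assms(5)] kerT' by simp
  have kerQ: "{x. ?Q x = 0} = {x. T x = 0}"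
    using ker_mp_corange[OF C clC] kerT by simp
  have kerQ': "{x. ?Q' x = 0} = {x. T x = 0}"
    using ker_mp_range[OF adjC closed_range_cadjoint[OF C clC]] kerT cadjoint_cadjoint[OF C] by simp
  note P = orth_proj_mp_range[OF B assms(5)]
    and Q = orth_proj_mp_corange[OF C clC]
    and Q' = orth_proj_mp_range[OF adjC closed_range_cadjoint[OF C clC]]
  have EP: "EP T \<longleftrightarrow> {x. cadjoint T x = 0} \<subseteq> {x. T x = 0} \<and> {x. T x = 0} \<subseteq> {x. cadjoint T x = 0}"
    using T assms(2) by (auto simp: EP_def)
  have a: "cadjoint T \<circ> T = cadjoint C \<circ> cadjoint B \<circ> B \<circ> C \<circ> B \<circ> moore_penrose B
      \<longleftrightarrow> {x. cadjoint T x = 0} \<subseteq> {x. T x = 0}"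
    using cadjoint_self_compose_proj_iff[OF T P] unfolding kerP
    by (simp only: assms(8) cadjoint_compose[OF B C] comp_assoc)
  have b: "cadjoint T \<circ> T = cadjoint C \<circ> cadjoint B \<circ> moore_penrose C \<circ> C \<circ> B \<circ> C
      \<longleftrightarrow> {x. T x = 0} \<subseteq> {x. cadjoint T x = 0}"
    using self_cadjoint_compose_proj_iff[OF adjT Q] unfolding kerQ cadjoint_cadjoint[OF T]
    by (simp only: assms(8) cadjoint_compose[OF B C] comp_assoc)
  have c: "T \<circ> cadjoint T = B \<circ> C \<circ> cadjoint C \<circ> cadjoint B \<circ> cadjoint C \<circ> moore_penrose (cadjoint C)
      \<longleftrightarrow> {x. T x = 0} \<subseteq> {x. cadjoint T x = 0}"
    using cadjoint_self_compose_proj_iff[OF adjT Q'] unfolding kerQ' cadjoint_cadjoint[OF T]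
    by (simp only: assms(8) cadjoint_compose[OF B C] comp_assoc)
  have d: "T \<circ> cadjoint T = B \<circ> C \<circ> B \<circ> moore_penrose B \<circ> cadjoint C \<circ> cadjoint B
      \<longleftrightarrow> {x. cadjoint T x = 0} \<subseteq> {x. T x = 0}"
    using self_cadjoint_compose_proj_iff[OF T P] unfolding kerP
    by (simp only: assms(8) cadjoint_compose[OF B C] comp_assoc)
  show ?thesis
    unfolding a b c d EP by blast
qed

end
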